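(* Let $D$ be a finite simple digraph with at least one vertex in which every vertex has out-degree at least $1$. Then $g(D) < 2\psi(D)$, where $\psi(D)=\sum_{v\in V(D)} \frac{1}{\deg^+(v)}$.
   Context: $\deg^+(v)$ denotes the out-degree of $v$. The girth $g(D)$ of a digraph is the length of a shortest directed cycle ($\infty$ if there is none). A simple digraph has no loops and no parallel edges (oppositely oriented edges between two vertices are allowed). *)

theory Defs
  imports "Graph_Theory.Graph_Theory" "HOL-Library.Extended_Nat" "HOL-Library.Extended_Real"
begin

(* An infimum in enat: it is attained when there is a cycle, and the infimum of the
   empty set is infinity. The length of a cycle is its number of arcs; cycles of
   length 2 (a pair of opposite arcs) count. *)
definition girth :: "('a, 'b) pre_digraph \<Rightarrow> enat" where
  "girth D = (INF c \<in> {c. pre_digraph.cycle D c}. enat (length c))"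

definition psi :: "('a, 'b) pre_digraph \<Rightarrow> real" where
  "psi D = (\<Sum>v\<in>verts D. 1 / real (out_degree D v))"

end

theory Submission
  imports Defs
begin

text \<open>
  Write \<open>\<phi>(D)\<close> for the sum of \<open>1 / (deg\<^sup>+(v) + 1)\<close> over the vertices; we show \<open>g(D) \<le> 2 \<phi>(D)\<close> by
  induction on the number of vertices. Deleting \<open>v\<close> changes \<open>\<phi>\<close> by \<open>- 1 / (deg\<^sup>+(v) + 1)\<close> plus
  \<open>1 / (deg\<^sup>+(u) (deg\<^sup>+(u) + 1))\<close> for every in-neighbour \<open>u\<close>, and these changes add up to \<open>0\<close> over
  all \<open>v\<close>. So some deletion does not increase \<open>\<phi>\<close>. If it creates sinks, that is, if some \<open>u\<close> has
  \<open>v\<close> as its only out-neighbour, let every such \<open>u\<close> inherit the out-neighbours of \<open>v\<close>: this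
  lowers \<open>\<phi>\<close> by at least \<open>1/2\<close> in total, while a cycle of the new digraph yields a cycle of \<open>D\<close>
  that is longer by at most one.
\<close>

lemma exists_le_of_sum_le:
  fixes f g :: "'a \<Rightarrow> real"
  assumes "finite A" "A \<noteq> {}" "sum f A \<le> sum g A"
  shows "\<exists>x\<in>A. f x \<le> g x"
  using sum_strict_mono[of A g f] assms by (meson leI linorder_not_le)

section \<open>Bypassing a vertex, and lifting walks back\<close>

definition bypass :: "'a \<Rightarrow> 'a rel \<Rightarrow> 'a rel" where
  "bypass v R = {(x, y). x \<noteq> v \<and> y \<noteq> v \<and> ((x, y) \<in> R \<or> R `` {x} = {v} \<and> (v, y) \<in> R)}"

lemma bypass_image:
  assumes "x \<noteq> v" "(v, v) \<notin> R"
  shows "bypass v R `` {x} = (if R `` {x} = {v} then R `` {v} else R `` {x} - {v})"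
  using assms by (auto simp: bypass_def)

lemma relpow_subset:
  fixes R S :: "'a rel"
  assumes "R \<subseteq> S"
  shows "R ^^ k \<subseteq> S ^^ k"
  using assms by (induction k) auto

text \<open>Each inherited arc stands for a detour through \<open>v\<close> and costs an extra step.
  Keeping only the part before the first detour reaches \<open>v\<close> and the part after the last
  one leaves it, the walk pays for a single detour, however many it used.\<close>

lemma bypass_relpow:
  assumes "(x, y) \<in> bypass v R ^^ k"
  shows "(x, y) \<in> R ^^ k \<or>
    (\<exists>i j. (x, v) \<in> R ^^ i \<and> (v, y) \<in> R ^^ j \<and> 0 < i \<and> i + j \<le> Suc k)"
  using assms
proof (induction k arbitrary: y)
  case 0
  then show ?case by simp
next
  case (Suc k)
  then obtain z where z: "(x, z) \<in> bypass v R ^^ k" "(z, y) \<in> bypass v R"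
    by (meson relpow_Suc_E)
  have arc: "(z, y) \<in> R \<or> (z, v) \<in> R \<and> (v, y) \<in> R"
    using z(2) by (auto simp: bypass_def)
  from Suc.IH[OF z(1)] show ?case
  proof (elim disjE exE conjE)
    assume xz: "(x, z) \<in> R ^^ k"
    from arc show ?thesis
    proof (elim disjE conjE)
      assume "(z, y) \<in> R"
      then show ?thesis using xz by (meson relpow_Suc_I)
    next
      assume "(z, v) \<in> R" "(v, y) \<in> R"
      then have "(x, v) \<in> R ^^ Suc k" "(v, y) \<in> R ^^ 1"
        using xz by auto
      then show ?thesis by (intro disjI2 exI[of _ "Suc k"] exI[of _ 1]) auto
    qed
  next
    fix i j
    assume ij: "(x, v) \<in> R ^^ i" "(v, z) \<in> R ^^ j" "0 < i" "i + j \<le> Suc k"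
    from arc show ?thesis
    proof (elim disjE conjE)
      assume "(z, y) \<in> R"
      then have "(v, y) \<in> R ^^ Suc j" using ij(2) by auto
      then show ?thesis using ij by (intro disjI2 exI[of _ i] exI[of _ "Suc j"]) auto
    next
      \<comment> \<open>A further detour: the stretch of length \<open>j\<close> between the two
        visits to \<open>v\<close> is cut out, so the second part restarts with length 1.\<close>
      assume "(v, y) \<in> R"
      then have "(v, y) \<in> R ^^ 1" by simp
      moreover have "i + 1 \<le> Suc (Suc k)" using ij(4) by simp
      ultimately show ?thesis using ij by blast
    qed
  qed
qed

text \<open>Lifted walks may repeat vertices, so the induction is about closed walks; a cycle is
  extracted only at the very end.\<close>

lemma bypass_closed_walk:
  assumes "(x, x) \<in> bypass v R ^^ k" "0 < k"
  obtains y l where "(y, y) \<in> R ^^ l" "0 < l" "l \<le> Suc k"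
proof -
  from bypass_relpow[OF assms(1)] show thesis
  proof (elim disjE exE conjE)
    assume "(x, x) \<in> R ^^ k"
    then show thesis using that[of x k] assms(2) by simp
  next
    fix i j
    assume ij: "(x, v) \<in> R ^^ i" "(v, x) \<in> R ^^ j" "0 < i" "i + j \<le> Suc k"
    then have "(v, v) \<in> R ^^ (j + i)" by (auto simp: relpow_add)
    then show thesis using that[of v "j + i"] ij by simp
  qed
qed

section \<open>The potential and its change under a bypass\<close>

definition phi :: "'a set \<Rightarrow> 'a rel \<Rightarrow> real" where
  "phi V R = (\<Sum>v\<in>V. 1 / (real (card (R `` {v})) + 1))"

text \<open>Without loops every out-degree is below \<open>card V\<close>, so each summand is at
  least \<open>1 / card V\<close>. This settles digraphs with a pair of opposite arcs.\<close>

lemma one_le_phi: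
  assumes "finite V" "V \<noteq> {}" "R \<subseteq> V \<times> V" "irrefl R"
  shows "1 \<le> phi V R"
proof -
  have "1 / real (card V) \<le> 1 / (real (card (R `` {v})) + 1)" if "v \<in> V" for v
  proof -
    have "R `` {v} \<subset> V" using assms(3,4) that by (auto simp: irrefl_def)
    then have "card (R `` {v}) < card V" using assms(1) by (simp add: psubset_card_mono)
    then show ?thesis by (intro divide_left_mono) auto
  qed
  then have "(\<Sum>v\<in>V. 1 / real (card V)) \<le> phi V R" unfolding phi_def by (rule sum_mono)
  then show ?thesis using assms(1,2) by simp
qed

lemma exists_cheap_deletion:
  assumes "finite V" "V \<noteq> {}" "R \<subseteq> V \<times> V" "\<And>v. v \<in> V \<Longrightarrow> R `` {v} \<noteq> {}"
  shows "\<exists>v\<in>V. (\<Sum>u | u \<in> V \<and> (u, v) \<in> R.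
      1 / (real (card (R `` {u})) * (real (card (R `` {u})) + 1)))
    \<le> 1 / (real (card (R `` {v})) + 1)"
proof (rule exists_le_of_sum_le[OF assms(1,2)])
  let ?c = "\<lambda>u. 1 / (real (card (R `` {u})) * (real (card (R `` {u})) + 1))"
  \<comment> \<open>Double counting: \<open>u\<close> is charged once per out-neighbour, and its d
    charges of \<open>1 / (d * (d + 1))\<close> add up to \<open>1 / (d + 1)\<close>, the gain from
    deleting \<open>u\<close> itself. This needs d > 0.\<close>
  have "(\<Sum>v\<in>V. \<Sum>u | u \<in> V \<and> (u, v) \<in> R. ?c u) = (\<Sum>u\<in>V. \<Sum>v | v \<in> V \<and> (u, v) \<in> R. ?c u)"
    by (rule sum.swap_restrict[OF assms(1) assms(1)])
  also have "\<dots> = (\<Sum>u\<in>V. 1 / (real (card (R `` {u})) + 1))"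
  proof (rule sum.cong[OF refl])
    fix u assume u: "u \<in> V"
    have "{v \<in> V. (u, v) \<in> R} = R `` {u}" using assms(3) by auto
    moreover have "card (R `` {u}) \<noteq> 0"
      using assms(1,3,4) u by (metis Image_singleton_iff SigmaD2 card_0_eq finite_subset subsetD subsetI)
    ultimately show "(\<Sum>v | v \<in> V \<and> (u, v) \<in> R. ?c u) = 1 / (real (card (R `` {u})) + 1)"
      by simp
  qed
  finally show "(\<Sum>v\<in>V. \<Sum>u | u \<in> V \<and> (u, v) \<in> R. ?c u) \<le> (\<Sum>v\<in>V. 1 / (real (card (R `` {v})) + 1))"
    by simp
qed

lemma phi_bypass_le:
  assumes fin: "finite V" and R: "R \<subseteq> V \<times> V" and irr: "irrefl R"
    and out: "\<And>v. v \<in> V \<Longrightarrow> R `` {v} \<noteq> {}" and v: "v \<in> V"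
    and cheap: "(\<Sum>u | u \<in> V \<and> (u, v) \<in> R.
      1 / (real (card (R `` {u})) * (real (card (R `` {u})) + 1)))
    \<le> 1 / (real (card (R `` {v})) + 1)"
  shows "phi (V - {v}) (bypass v R) \<le> phi V R - card {u. R `` {u} = {v}} / 2"
proof -
  let ?d = "\<lambda>u. real (card (R `` {u}))"
  let ?c = "\<lambda>u. 1 / (?d u * (?d u + 1))"
  let ?U = "{u. R `` {u} = {v}}"
  have finR: "finite (R `` {u})" for u
    by (rule finite_subset[OF _ fin]) (use R in auto)
  have d1: "1 \<le> ?d u" if "u \<in> V" for u
    using out[OF that] finR[of u] by (simp add: Suc_le_eq card_gt_0_iff)
  have vv: "(v, v) \<notin> R" using irr by (auto simp: irrefl_def)
  have U: "?U \<subseteq> V - {v}" using R vv by auto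
  have summand: "1 / (real (card (bypass v R `` {u})) + 1)
      \<le> 1 / (?d u + 1) + (if (u, v) \<in> R then ?c u else 0) - (if u \<in> ?U then 1 / 2 else 0)"
    if u: "u \<in> V - {v}" for u
  proof (cases "u \<in> ?U")
    case True
    then have "(u, v) \<in> R" by auto
    \<comment> \<open>Here \<open>?d u = 1\<close>, and mere deletion is budgeted to raise the
      summand from 1/2 to 1. Inheriting the out-neighbours of \<open>v\<close> keeps it at most 1/2,
      which saves 1/2.\<close>
    moreover have "1 / (?d v + 1) \<le> 1 / 2" using d1[OF v] by (intro divide_left_mono) auto
    ultimately show ?thesis using True u vv by (simp add: bypass_image)
  next
    case False
    have du: "1 \<le> ?d u" using d1 u by simp
    show ?thesis
    proof (cases "(u, v) \<in> R")
      case True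
      then have "card (R `` {u} - {v}) = card (R `` {u}) - 1"
        by (simp add: card_Diff_singleton)
      then have "real (card (bypass v R `` {u})) + 1 = ?d u"
        using False u vv du by (simp add: bypass_image)
      moreover have "1 / ?d u = 1 / (?d u + 1) + ?c u"
        using du by (simp add: divide_simps)
      ultimately show ?thesis using True False by simp
    next
      case nR: False
      then have "R `` {u} - {v} = R `` {u}" by auto
      then show ?thesis using False nR u vv by (simp add: bypass_image)
    qed
  qed
  have "phi (V - {v}) (bypass v R)
      \<le> (\<Sum>u\<in>V - {v}. 1 / (?d u + 1) + (if (u, v) \<in> R then ?c u else 0) - (if u \<in> ?U then 1 / 2 else 0))"
    unfolding phi_def by (rule sum_mono) (rule summand)
  also have "\<dots> = (\<Sum>u\<in>V - {v}. 1 / (?d u + 1)) + (\<Sum>u\<in>V - {v}. if (u, v) \<in> R then ?c u else 0)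
      - (\<Sum>u\<in>V - {v}. if u \<in> ?U then 1 / 2 else 0)"
    by (simp only: sum.distrib sum_subtractf)
  also have "(\<Sum>u\<in>V - {v}. 1 / (?d u + 1)) = phi V R - 1 / (?d v + 1)"
    unfolding phi_def using fin v by (simp add: sum_diff1)
  also have "(\<Sum>u\<in>V - {v}. if (u, v) \<in> R then ?c u else 0) = (\<Sum>u | u \<in> V \<and> (u, v) \<in> R. ?c u)"
  proof -
    have "{u \<in> V. (u, v) \<in> R} = {u \<in> V - {v}. (u, v) \<in> R}" using vv by auto
    then show ?thesis using fin by (simp only: sum.inter_filter finite_Diff)
  qed
  also have "(\<Sum>u\<in>V - {v}. if u \<in> ?U then 1 / 2 else 0) = card ?U / 2"
  proof -
    have "(\<Sum>u\<in>V - {v}. if u \<in> ?U then 1 / 2 else 0) = (\<Sum>u\<in>(V - {v}) \<inter> ?U. 1 / 2 :: real)"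
      by (rule sum.inter_restrict[symmetric]) (use fin in simp)
    also have "(V - {v}) \<inter> ?U = ?U" using U by blast
    finally show ?thesis by simp
  qed
  finally show ?thesis using cheap by linarith
qed

section \<open>Induction on the number of vertices\<close>

lemma exists_short_closed_walk:
  assumes "finite V" "V \<noteq> {}" "R \<subseteq> V \<times> V" "irrefl R" "\<And>v. v \<in> V \<Longrightarrow> R `` {v} \<noteq> {}"
  shows "\<exists>x k. (x, x) \<in> R ^^ k \<and> 0 < k \<and> real k \<le> 2 * phi V R"
  using assms
proof (induction "card V" arbitrary: V R rule: less_induct)
  case less
  note fin = less.prems(1) and R = less.prems(3) and irr = less.prems(4) and out = less.prems(5)
  show ?case
  \<comment> \<open>Opposite arcs are treated first because a bypass could turn them into a loop: if
    \<open>u\<close> inherits from \<open>v\<close> and \<open>(v, u)\<close> is an arc, then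
    \<open>u\<close> would become its own out-neighbour.\<close>
  proof (cases "\<exists>x y. (x, y) \<in> R \<and> (y, x) \<in> R")
    case True
    then obtain x y where "(x, y) \<in> R" "(y, x) \<in> R" by blast
    then have "(x, x) \<in> R ^^ 2" by (auto simp: numeral_2_eq_2)
    then show ?thesis
      using one_le_phi[OF less.prems(1-4)] by (intro exI[of _ x] exI[of _ 2]) auto
  next
    case asym: False
    obtain v where v: "v \<in> V" and cheap: "(\<Sum>u | u \<in> V \<and> (u, v) \<in> R.
        1 / (real (card (R `` {u})) * (real (card (R `` {u})) + 1)))
      \<le> 1 / (real (card (R `` {v})) + 1)"
      using exists_cheap_deletion[OF less.prems(1-3,5)] by blast
    have vv: "(v, v) \<notin> R" using irr by (auto simp: irrefl_def)
    let ?U = "{u. R `` {u} = {v}}"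
    let ?R = "bypass v R"
    have le: "phi (V - {v}) ?R \<le> phi V R - card ?U / 2"
      using fin R irr out v cheap by (rule phi_bypass_le)
    have "\<exists>x k. (x, x) \<in> ?R ^^ k \<and> 0 < k \<and> real k \<le> 2 * phi (V - {v}) ?R"
    proof (rule less.hyps)
      show "card (V - {v}) < card V" using fin v by (rule card_Diff1_less)
      show "finite (V - {v})" using fin by simp
      show "V - {v} \<noteq> {}" using out[OF v] R vv by auto
      show "?R \<subseteq> (V - {v}) \<times> (V - {v})" using R by (auto simp: bypass_def)
      show "irrefl ?R" using irr asym by (auto simp: irrefl_def bypass_def)
      show "?R `` {u} \<noteq> {}" if "u \<in> V - {v}" for u
        using that out[OF v] out[of u] vv by (auto simp: bypass_image)
    qed
    then obtain x k where k: "(x, x) \<in> ?R ^^ k" "0 < k" "real k \<le> 2 * phi (V - {v}) ?R"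
      by blast
    show ?thesis
    proof (cases "?U = {}")
      case True
      \<comment> \<open>With no heirs the bypass is plain deletion, so the walk already lives in
        \<open>R\<close>.\<close>
      then have "?R \<subseteq> R" by (auto simp: bypass_def)
      then have "(x, x) \<in> R ^^ k" using k(1) relpow_subset by blast
      moreover have "real k \<le> 2 * phi V R" using k(3) le True by simp
      ultimately show ?thesis using k(2) by blast
    next
      case False
      have "finite ?U" by (rule finite_subset[OF _ fin]) (use R in auto)
      then have "1 \<le> card ?U" using False by (simp add: Suc_le_eq card_gt_0_iff)
      \<comment> \<open>A single heir lowers \<open>2 * phi\<close> by 1, which pays for the one
        extra step of the lifted walk.\<close>
      then have "real k + 1 \<le> 2 * phi V R" using k(3) le by simp
      moreover obtain y l where "(y, y) \<in> R ^^ l" "0 < l" "l \<le> Suc k"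
        using k(1,2) by (rule bypass_closed_walk)
      ultimately show ?thesis by (intro exI[of _ y] exI[of _ l]) auto
    qed
  qed
qed

section \<open>From closed walks of a relation to cycles of a digraph\<close>

context wf_digraph
begin

lemma relpow_imp_awalk:
  assumes "(u, v) \<in> arcs_ends G ^^ k" "u \<in> verts G"
  shows "\<exists>p. awalk u p v \<and> length p = k"
  using assms
proof (induction k arbitrary: u)
  case 0
  then show ?case by (auto simp: awalk_Nil_iff)
next
  case (Suc k)
  then obtain w where w: "(u, w) \<in> arcs_ends G" "(w, v) \<in> arcs_ends G ^^ k"
    by (meson relpow_Suc_E2)
  then obtain e where e: "e \<in> arcs G" "tail G e = u" "head G e = w" by blast
  then obtain p where "awalk w p v" "length p = k" using Suc.IH[OF w(2)] by auto
  then show ?case using e by (intro exI[of _ "e # p"]) (auto simp: awalk_Cons_iff)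
qed

lemma closed_w_imp_short_cycle:
  assumes "closed_w p"
  shows "\<exists>c. cycle c \<and> length c \<le> length p"
  using assms
proof (induction "length p" arbitrary: p rule: less_induct)
  case less
  then obtain u where u: "awalk u p u" "p \<noteq> []" by (auto simp: closed_w_def)
  then obtain e es where p: "p = e # es" by (cases p) auto
  show ?case
  proof (cases "distinct (tl (awalk_verts u p))")
    case True
    then show ?thesis using u by (auto simp: cycle_def)
  next
    case False
    \<comment> \<open>The first arc is split off because the end vertex of a closed walk repeats its
      start. The repetition now lies within \<open>es\<close>, so the closed subwalk found there is
      strictly shorter than \<open>p\<close>.\<close>
    then have es: "awalk (head G e) es u" "\<not> distinct (awalk_verts (head G e) es)"
      using u p by (auto simp: awalk_Cons_iff)
    obtain q r s where "es = q @ r @ s" "closed_w r"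
      using awalk_not_distinct_decomp[OF es] by (auto simp: closed_w_def)
    then show ?thesis using less.hyps[of r] p by force
  qed
qed

end

lemma (in nomulti_digraph) card_arcs_ends_Image:
  "card (arcs_ends G `` {v}) = out_degree G v"
proof -
  have "arcs_ends G `` {v} = head G ` out_arcs G v"
    by (auto simp: arcs_ends_conv out_arcs_def)
  moreover have "inj_on (head G) (out_arcs G v)"
    by (auto simp: inj_on_def out_arcs_def arc_to_ends_def intro: no_multi_arcs)
  ultimately show ?thesis by (simp add: card_image out_degree_def)
qed

theorem theorem1p3:
  fixes D :: "('a, 'b) pre_digraph"
  assumes "digraph D"
    and "verts D \<noteq> {}"
    and "\<And>v. v \<in> verts D \<Longrightarrow> out_degree D v \<ge> 1"
  shows "ereal_of_enat (girth D) < ereal (2 * psi D)"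
proof -
  interpret digraph D by fact
  let ?R = "arcs_ends D"
  have "?R `` {v} \<noteq> {}" if "v \<in> verts D" for v
    using assms(3)[OF that] card_arcs_ends_Image[of v] by force
  moreover have "irrefl ?R" using adj_not_same by (auto simp: irrefl_def)
  moreover have sub: "?R \<subseteq> verts D \<times> verts D" by (auto simp: arcs_ends_conv)
  ultimately obtain x k where k: "(x, x) \<in> ?R ^^ k" "0 < k" "real k \<le> 2 * phi (verts D) ?R"
    using exists_short_closed_walk[OF finite_verts assms(2)] by metis
  \<comment> \<open>Uses \<open>0 < k\<close>: the zeroth power of a relation also relates points
    outside \<open>verts D\<close> to themselves.\<close>
  have "x \<in> verts D" using k(1,2) sub by (cases k) (auto elim!: relpow_Suc_E2)
  then obtain p where "awalk x p x" "length p = k" using relpow_imp_awalk[OF k(1)] by blast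
  then obtain c where c: "cycle c" "length c \<le> k"
    using closed_w_imp_short_cycle[of p] k(2) by (auto simp: closed_w_def)
  have "girth D \<le> enat (length c)" unfolding girth_def using c(1) by (intro INF_lower) simp
  also have "\<dots> \<le> enat k" using c(2) by simp
  finally have "ereal_of_enat (girth D) \<le> ereal_of_enat (enat k)"
    by (simp only: ereal_of_enat_le_iff)
  also have "\<dots> = ereal (real k)" by simp
  also have "\<dots> < ereal (2 * psi D)"
  proof -
    \<comment> \<open>The strictness of the theorem arises here, termwise. Positive out-degrees
      matter, since \<open>1 / 0 = 0\<close> would reverse the comparison at a sink.\<close>
    have "phi (verts D) ?R < psi D"
      unfolding phi_def psi_def card_arcs_ends_Image
    proof (rule sum_strict_mono[OF finite_verts assms(2)])
      fix v assume "v \<in> verts D"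
      then show "1 / (real (out_degree D v) + 1) < 1 / real (out_degree D v)"
        using assms(3)[of v] by (simp add: field_simps)
    qed
    then show ?thesis using k(3) by simp
  qed
  finally show ?thesis .
qed

end
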